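(* Let $R$ be an integral domain of characteristic zero, $\mathcal A$ a (commutative) integral domain containing $R$, and $\phi$ an $R$-algebra endomorphism of $\mathcal A$ that is algebraic over $R$. Set $\operatorname{Ker}_{\ge1}\phi:=\sum_{i\ge1}\operatorname{Ker}\phi^i$. Then $$\mathfrak r\big(\operatorname{Im}(\mathrm I-\phi)\big)=\mathfrak r\big(\operatorname{Ker}_{\ge1}\phi\big).$$ Consequently, $\operatorname{Im}(\mathrm I-\phi)$ is a Mathieu subspace of $\mathcal A$.
   Context: $\mathrm I$ denotes the identity map of $\mathcal A$ and $\operatorname{Im}$ denotes the image of a map. An $R$-algebra endomorphism is an $R$-linear multiplicative map $\mathcal A\to\mathcal A$, not required to send $1$ to $1$. $\phi$ is algebraic over $R$ if there is a nonzero $f(t)\in R[t]$ with $f(\phi)=0$. For an $R$-submodule $V$ of an $R$-algebra $\mathcal A$, the radical $\mathfrak r(V)$ is the set of $a\in\mathcal A$ such that $a^m\in V$ for all sufficiently large $m$. $V$ is a (two-sided) Mathieu subspace of $\mathcal A$ if for all $a,b,c\in\mathcal A$ with $a^m\in V$ for all $m\ge1$, one has $ba^mc\in V$ for all sufficiently large $m$. *)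

theory Defs
  imports Main "HOL-Computational_Algebra.Polynomial"
begin

locale algebra_over = module scale
  for scale :: "'r::comm_ring_1 \<Rightarrow> 'a::ring_1 \<Rightarrow> 'a" (infixr \<open>*s\<close> 75) +
  assumes scale_mult_left: "(r *s x) * y = r *s (x * y)"
    and scale_mult_right: "x * (r *s y) = r *s (x * y)"
begin

text \<open>Endomorphisms are not required to preserve \<^term>\<open>1\<close>.\<close>

definition algebra_endo :: "('a \<Rightarrow> 'a) \<Rightarrow> bool" where
  "algebra_endo \<phi> \<longleftrightarrow> module_hom scale scale \<phi> \<and> (\<forall>x y. \<phi> (x * y) = \<phi> x * \<phi> y)"

definition poly_at_map :: "'r poly \<Rightarrow> ('a \<Rightarrow> 'a) \<Rightarrow> 'a \<Rightarrow> 'a" where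
  "poly_at_map f \<phi> = (\<lambda>a. \<Sum>i\<le>degree f. coeff f i *s (\<phi> ^^ i) a)"

definition algebraic_map :: "('a \<Rightarrow> 'a) \<Rightarrow> bool" where
  "algebraic_map \<phi> \<longleftrightarrow> (\<exists>f. f \<noteq> 0 \<and> poly_at_map f \<phi> = (\<lambda>_. 0))"

definition mathieu_subspace :: "'a set \<Rightarrow> bool" where
  "mathieu_subspace V \<longleftrightarrow> subspace V \<and>
     (\<forall>a b c. (\<forall>m\<ge>1. a ^ m \<in> V) \<longrightarrow> (\<exists>N. \<forall>m\<ge>N. b * a ^ m * c \<in> V))"

end

definition mradical :: "'a::monoid_mult set \<Rightarrow> 'a set" where
  "mradical V = {a. \<exists>N. \<forall>m\<ge>N. a ^ m \<in> V}"

text \<open>The sum of the infinite family of kernels consists of all sums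
  \<open>\<Sum>i\<in>I. x i\<close> over a finite set \<open>I\<close> of positive indices, with \<open>x i\<close> in the
  kernel of the \<open>i\<close>-th iterate.\<close>

definition ker_ge1 :: "('a::comm_monoid_add \<Rightarrow> 'a) \<Rightarrow> 'a set" where
  "ker_ge1 \<phi> = {\<Sum>i\<in>I. x i | I x. finite I \<and> I \<subseteq> {1..} \<and> (\<forall>i\<in>I. (\<phi> ^^ i) (x i) = 0)}"

end

(* By Dedekind's independence of characters, an algebraic multiplicative map of a domain
   satisfies phi^(i+d) = phi^i for some i and some d > 0.  If a^m = b - phi b, then
   c = phi^i a satisfies sum_{j<d} (phi^j c)^m = 0 by telescoping.  If this holds for all
   large m, then independence of the characters m |-> y^m together with characteristic zero
   forces c = 0.  So both radicals consist of the elements killed by a power of phi. *)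
theory Submission imports Defs begin

text \<open>Dedekind's argument uses only multiplicativity, so \<open>op\<close> need be neither
  associative nor unital. This allows both composite-free uses below: iterates of
  \<open>\<phi>\<close> as functions of a ring element, and powers as functions of the
  exponent.\<close>

lemma characters_independent:
  fixes \<chi> :: "'i \<Rightarrow> 'm \<Rightarrow> 'a::idom" and op :: "'m \<Rightarrow> 'm \<Rightarrow> 'm"
  assumes "finite S" and "inj_on \<chi> S"
    and mult: "\<And>s x y. s \<in> S \<Longrightarrow> \<chi> s (op x y) = \<chi> s x * \<chi> s y"
    and nonzero: "\<And>s. s \<in> S \<Longrightarrow> \<exists>x. \<chi> s x \<noteq> 0"
    and "\<And>x. (\<Sum>s\<in>S. c s * \<chi> s x) = 0"
    and "s \<in> S"
  shows "c s = 0"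
  using assms
proof (induction S arbitrary: c s rule: finite_induct)
  case empty
  then show ?case by simp
next
  case (insert t T)
  have sum0: "c t * \<chi> t x + (\<Sum>s\<in>T. c s * \<chi> s x) = 0" for x
    using insert.prems(4)[of x] insert.hyps by simp
  have cT: "c u = 0" if u: "u \<in> T" for u
  proof -
    \<comment> \<open>Subtracting \<open>\<chi> t y\<close> times the relation at \<open>x\<close>
      from the relation at \<open>op y x\<close> cancels the term of \<open>t\<close> and leaves a
      relation over \<open>T\<close> with these coefficients.\<close>
    have "c u * (\<chi> u y - \<chi> t y) = 0" for y
    proof (rule insert.IH[OF _ _ _ _ u])
      show "inj_on \<chi> T" using insert.prems(1) by (rule inj_on_subset) auto
      show "\<chi> s (op x y) = \<chi> s x * \<chi> s y" if "s \<in> T" for s x y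
        using insert.prems(2) that by blast
      show "\<exists>x. \<chi> s x \<noteq> 0" if "s \<in> T" for s
        using insert.prems(3) that by blast
      show "(\<Sum>s\<in>T. c s * (\<chi> s y - \<chi> t y) * \<chi> s x) = 0" for x
      proof -
        have "(\<Sum>s\<in>T. c s * (\<chi> s y - \<chi> t y) * \<chi> s x)
            = (\<Sum>s\<in>T. c s * \<chi> s (op y x)) - \<chi> t y * (\<Sum>s\<in>T. c s * \<chi> s x)"
          unfolding sum_distrib_left sum_subtractf[symmetric]
          by (rule sum.cong) (auto simp: insert.prems(2) algebra_simps)
        also have "\<dots> = - (c t * \<chi> t (op y x)) - \<chi> t y * (- (c t * \<chi> t x))"
          using sum0[of "op y x"] sum0[of x] by (simp add: add_eq_0_iff)
        also have "\<dots> = 0"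
          by (simp add: insert.prems(2))
        finally show ?thesis .
      qed
    qed
    moreover obtain y where "\<chi> u y \<noteq> \<chi> t y"
      using insert.prems(1) u insert.hyps(2) by (metis ext inj_onD insertCI)
    ultimately show ?thesis by (metis mult_eq_0_iff right_minus_eq)
  qed
  moreover have "c t = 0"
  proof -
    obtain x where "\<chi> t x \<noteq> 0" using insert.prems(3) by blast
    with sum0[of x] cT show ?thesis by simp
  qed
  ultimately show ?case using insert.prems(5) by blast
qed

text \<open>Grouping equal values turns the sums into a relation between distinct characters of the
  exponent. Its coefficients are multiplicities, which are nonzero in characteristic zero.\<close>

lemma power_sums_eq_0:
  fixes x :: "'i \<Rightarrow> 'a::idom"
  assumes char0: "\<And>n. n > 0 \<Longrightarrow> of_nat n \<noteq> (0::'a)"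
    and fin: "finite I"
    and sums: "\<And>m. m \<ge> N \<Longrightarrow> (\<Sum>i\<in>I. x i ^ m) = 0"
    and i: "i \<in> I"
  shows "x i = 0"
proof (rule ccontr)
  assume xi: "x i \<noteq> 0"
  define Y where "Y = x ` I - {0}"
  define k where "k y = card {j\<in>I. x j = y}" for y
  have "of_nat (k (x i)) = (0::'a)"
  proof (rule characters_independent[where S = Y and \<chi> = "\<lambda>y m. y ^ (m + Suc N)"
        and op = "\<lambda>m n. m + n + Suc N" and c = "\<lambda>y. of_nat (k y)" and s = "x i"])
    show "finite Y" using fin by (simp add: Y_def)
    show "inj_on (\<lambda>y m. y ^ (m + Suc N)) Y"
    proof (rule inj_onI)
      fix y z :: 'a
      assume "y \<in> Y" and eq: "(\<lambda>m. y ^ (m + Suc N)) = (\<lambda>m. z ^ (m + Suc N))"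
      then have "y \<noteq> 0" by (simp add: Y_def)
      \<comment> \<open>Cancelling the common power at exponent 0 from the equation at exponent 1
        recovers the base.\<close>
      have "y * y ^ Suc N = z * z ^ Suc N" "y ^ Suc N = z ^ Suc N"
        using fun_cong[OF eq, of 1] fun_cong[OF eq, of 0] by simp_all
      with \<open>y \<noteq> 0\<close> show "y = z" by (metis mult_right_cancel power_not_zero)
    qed
    show "(\<Sum>y\<in>Y. of_nat (k y) * y ^ (m + Suc N)) = 0" for m
    proof -
      have "(\<Sum>y\<in>Y. of_nat (k y) * y ^ (m + Suc N))
          = (\<Sum>y\<in>x ` I. of_nat (k y) * y ^ (m + Suc N))"
        by (rule sum.mono_neutral_left) (auto simp: Y_def fin)
      also have "\<dots> = (\<Sum>y\<in>x ` I. \<Sum>j\<in>{j\<in>I. x j = y}. x j ^ (m + Suc N))"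
        by (rule sum.cong) (auto simp: k_def)
      also have "\<dots> = (\<Sum>j\<in>I. x j ^ (m + Suc N))"
        by (rule sum.image_gen[OF fin, symmetric])
      finally show ?thesis using sums[of "m + Suc N"] by simp
    qed
    show "x i \<in> Y" using i xi by (simp add: Y_def)
    show "\<exists>m. y ^ (m + Suc N) \<noteq> 0" if "y \<in> Y" for y
      using that by (auto simp: Y_def)
  qed (simp add: power_add algebra_simps)
  moreover have "k (x i) > 0"
    using fin i by (auto simp: k_def card_gt_0_iff)
  ultimately show False using char0 by blast
qed

context
  fixes \<phi> :: "'a::idom \<Rightarrow> 'a"
  assumes add: "\<And>x y. \<phi> (x + y) = \<phi> x + \<phi> y"
    and mult: "\<And>x y. \<phi> (x * y) = \<phi> x * \<phi> y"
begin

lemma funpow_add_hom: "(\<phi> ^^ n) (x + y) = (\<phi> ^^ n) x + (\<phi> ^^ n) y"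
  by (induction n) (simp_all add: add)

lemma funpow_mult_hom: "(\<phi> ^^ n) (x * y) = (\<phi> ^^ n) x * (\<phi> ^^ n) y"
  by (induction n) (simp_all add: mult)

lemma funpow_zero: "(\<phi> ^^ n) 0 = 0"
  using funpow_add_hom[of n 0 0] by (metis add.right_neutral add_cancel_left_left)

lemma funpow_diff_hom: "(\<phi> ^^ n) (x - y) = (\<phi> ^^ n) x - (\<phi> ^^ n) y"
  using funpow_add_hom[of n "x - y" y] by simp

text \<open>The exponent is a successor because \<open>\<phi>\<close> may move 1.\<close>

lemma funpow_power_hom: "(\<phi> ^^ n) (x ^ Suc m) = ((\<phi> ^^ n) x) ^ Suc m"
  by (induction m) (simp_all add: funpow_mult_hom)

lemma funpow_eq_0_mono: "(\<phi> ^^ m) x = 0 \<Longrightarrow> m \<le> n \<Longrightarrow> (\<phi> ^^ n) x = 0"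
  by (metis comp_apply funpow_add funpow_zero le_add_diff_inverse2)

lemma sum_funpow_diff: "(\<Sum>j<d. (\<phi> ^^ j) (b - \<phi> b)) = b - (\<phi> ^^ d) b"
  using sum_lessThan_telescope'[of "\<lambda>j. (\<phi> ^^ j) b" d]
  by (simp add: funpow_diff_hom funpow_swap1)

text \<open>The kernels of the iterates form an increasing chain, so their sum is their
  union.\<close>

lemma ker_ge1_iff: "a \<in> ker_ge1 \<phi> \<longleftrightarrow> (\<exists>k. (\<phi> ^^ k) a = 0)"
proof
  assume "a \<in> ker_ge1 \<phi>"
  then obtain I x where I: "finite I" "\<forall>i\<in>I. (\<phi> ^^ i) (x i) = 0" and a: "a = (\<Sum>i\<in>I. x i)"
    unfolding ker_ge1_def by blast
  have hom: "(\<phi> ^^ n) (\<Sum>i\<in>I. x i) = (\<Sum>i\<in>I. (\<phi> ^^ n) (x i))" for n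
    using I(1) by (induction I rule: finite_induct) (simp_all add: funpow_zero funpow_add_hom)
  have "(\<phi> ^^ Max I) a = 0"
    unfolding a hom using I by (auto intro!: sum.neutral intro: funpow_eq_0_mono)
  then show "\<exists>k. (\<phi> ^^ k) a = 0" ..
next
  assume "\<exists>k. (\<phi> ^^ k) a = 0"
  then obtain k where "(\<phi> ^^ k) a = 0" ..
  \<comment> \<open>\<open>k\<close> may be 0, whereas \<open>ker_ge1\<close> admits positive
    indices only.\<close>
  then have "(\<phi> ^^ Suc k) a = 0" by (rule funpow_eq_0_mono) simp
  then show "a \<in> ker_ge1 \<phi>"
    unfolding ker_ge1_def by (intro CollectI exI[of _ "{Suc k}"] exI[of _ "\<lambda>_. a"]) simp
qed

text \<open>An iterate killing a positive power of \<open>a\<close> kills \<open>a\<close> itself,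
  since a domain has no nilpotents.\<close>

lemma mradical_ker_ge1: "a \<in> mradical (ker_ge1 \<phi>) \<longleftrightarrow> (\<exists>k. (\<phi> ^^ k) a = 0)"
proof
  assume "a \<in> mradical (ker_ge1 \<phi>)"
  then obtain N where "a ^ Suc N \<in> ker_ge1 \<phi>"
    unfolding mradical_def using le_SucI by blast
  then show "\<exists>k. (\<phi> ^^ k) a = 0"
    unfolding ker_ge1_iff funpow_power_hom by (metis power_not_zero)
next
  assume "\<exists>k. (\<phi> ^^ k) a = 0"
  then obtain k where "(\<phi> ^^ k) a = 0" ..
  then have "a ^ m \<in> ker_ge1 \<phi>" if "m \<ge> 1" for m
    unfolding ker_ge1_iff using that by (cases m) (auto simp: funpow_mult_hom)
  then show "a \<in> mradical (ker_ge1 \<phi>)" unfolding mradical_def by blast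
qed

text \<open>The geometric series for the inverse of \<open>I - \<phi>\<close> terminates at
  \<open>a\<close>; its sum is the preimage.\<close>

lemma range_id_minus_if_funpow_eq_0:
  assumes "(\<phi> ^^ k) a = 0"
  shows "a \<in> range (\<lambda>a. a - \<phi> a)"
proof -
  have hom: "\<phi> (\<Sum>j<k. (\<phi> ^^ j) a) = (\<Sum>j<k. (\<phi> ^^ Suc j) a)" for k
    using funpow_zero[of 1] by (induction k) (simp_all add: add)
  have "(\<Sum>j<k. (\<phi> ^^ j) a) - \<phi> (\<Sum>j<k. (\<phi> ^^ j) a) = a"
    unfolding hom sum_subtractf[symmetric]
    using sum_lessThan_telescope'[of "\<lambda>j. (\<phi> ^^ j) a" k] assms by simp
  then show ?thesis by (metis rangeI)
qed

lemma funpow_eq_0_if_mradical_range: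
  assumes char0: "\<And>n. n > 0 \<Longrightarrow> of_nat n \<noteq> (0::'a)"
    and d: "d > 0" and periodic: "\<phi> ^^ (d + i) = \<phi> ^^ i"
    and a: "a \<in> mradical (range (\<lambda>a. a - \<phi> a))"
  shows "(\<phi> ^^ i) a = 0"
proof -
  obtain N where N: "\<And>m. m \<ge> N \<Longrightarrow> a ^ m \<in> range (\<lambda>a. a - \<phi> a)"
    using a unfolding mradical_def by blast
  have "(\<phi> ^^ 0) ((\<phi> ^^ i) a) = 0"
  \<comment> \<open>The sum runs over one period, and the wanted element is its term at index 0. The
    bound \<open>Suc N\<close> excludes exponent 0, at which \<open>\<phi>\<close> need not respect
    powers.\<close>
  proof (rule power_sums_eq_0[OF char0, of "{..<d}" "Suc N" "\<lambda>j. (\<phi> ^^ j) ((\<phi> ^^ i) a)"])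
    fix m assume m: "m \<ge> Suc N"
    then obtain b where b: "a ^ m = b - \<phi> b" using N[of m] by auto
    have "((\<phi> ^^ j) ((\<phi> ^^ i) a)) ^ m = (\<phi> ^^ j) ((\<phi> ^^ i) b - \<phi> ((\<phi> ^^ i) b))" for j
    proof -
      have "((\<phi> ^^ j) ((\<phi> ^^ i) a)) ^ m = (\<phi> ^^ j) ((\<phi> ^^ i) (a ^ m))"
        using m by (metis Suc_le_D funpow_power_hom)
      then show ?thesis by (simp add: b funpow_diff_hom funpow_swap1)
    qed
    then have "(\<Sum>j<d. ((\<phi> ^^ j) ((\<phi> ^^ i) a)) ^ m) = (\<phi> ^^ i) b - (\<phi> ^^ (d + i)) b"
      by (simp add: sum_funpow_diff funpow_add)
    then show "(\<Sum>j<d. ((\<phi> ^^ j) ((\<phi> ^^ i) a)) ^ m) = 0" by (simp add: periodic)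
  qed (use d in auto)
  then show ?thesis by simp
qed

text \<open>If no two iterates agreed, the iterates up to \<open>n\<close> would be distinct nonzero
  characters, hence independent.\<close>

lemma funpow_periodic_if_relation:
  assumes rel: "\<And>x. (\<Sum>i\<le>n. c i * (\<phi> ^^ i) x) = 0" and nz: "k \<le> n" "c k \<noteq> 0"
  shows "\<exists>d i. d > 0 \<and> \<phi> ^^ (d + i) = \<phi> ^^ i"
proof (rule ccontr)
  assume "\<not> ?thesis"
  then have aperiodic: "\<phi> ^^ (d + i) \<noteq> \<phi> ^^ i" if "d > 0" for d i
    using that by blast
  have "c k = 0"
  proof (rule characters_independent[OF _ _ funpow_mult_hom _ rel])
    show "inj_on (\<lambda>i. \<phi> ^^ i) {..n}"
      by (rule linorder_inj_onI) (metis aperiodic le_add_diff_inverse2 less_imp_le zero_less_diff, auto)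
    \<comment> \<open>A vanishing iterate equals the next one, so it would already give period
      1.\<close>
    show "\<exists>x. (\<phi> ^^ i) x \<noteq> 0" for i
    proof (rule ccontr)
      assume "\<nexists>x. (\<phi> ^^ i) x \<noteq> 0"
      then have "\<phi> ^^ (1 + i) = \<phi> ^^ i"
        using funpow_zero[of 1] by (auto simp: fun_eq_iff)
      then show False using aperiodic[of 1 i] by simp
    qed
  qed (use nz in auto)
  then show False using nz by simp
qed

end

theorem proposition6p8:
  fixes scale :: "'r::{idom, ring_char_0} \<Rightarrow> 'a::idom \<Rightarrow> 'a"
    and \<phi> :: "'a \<Rightarrow> 'a"
  assumes "algebra_over scale"
    and "inj (\<lambda>r. scale r 1)"
    and "algebra_over.algebra_endo scale \<phi>"
    and "algebra_over.algebraic_map scale \<phi>"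
  shows "mradical (range (\<lambda>a. a - \<phi> a)) = mradical (ker_ge1 \<phi>) \<and>
    algebra_over.mathieu_subspace scale (range (\<lambda>a. a - \<phi> a))"
proof -
  interpret algebra_over scale by fact
  have hom: "module_hom scale scale \<phi>" and mult: "\<And>x y. \<phi> (x * y) = \<phi> x * \<phi> y"
    using assms(3) by (auto simp: algebra_endo_def)
  interpret \<phi>: module_hom scale scale \<phi> by fact
  note endo = \<phi>.add mult
  have scale_eq_0: "scale r 1 = 0 \<longleftrightarrow> r = 0" for r
    using injD[OF assms(2), of r 0] by auto
  have char0: "of_nat n \<noteq> (0::'a)" if "n > 0" for n
  proof -
    have "scale (of_nat n) 1 = (of_nat n :: 'a)" for n
      by (induction n) (simp_all add: scale_left_distrib)
    then show ?thesis using scale_eq_0[of "of_nat n"] that by simp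
  qed
  obtain f where f: "f \<noteq> 0" "poly_at_map f \<phi> = (\<lambda>_. 0)"
    using assms(4) unfolding algebraic_map_def by blast
  \<comment> \<open>The coefficients are moved into the algebra, where independence applies;
    injectivity of the embedding keeps the leading one nonzero.\<close>
  have rel: "(\<Sum>i\<le>degree f. scale (coeff f i) 1 * (\<phi> ^^ i) x) = 0" for x
    using fun_cong[OF f(2), of x] by (simp add: poly_at_map_def scale_mult_left)
  have "scale (coeff f (degree f)) 1 \<noteq> 0"
    using f(1) by (simp add: scale_eq_0)
  then obtain d i where "d > 0" "\<phi> ^^ (d + i) = \<phi> ^^ i"
    using funpow_periodic_if_relation[OF endo rel order_refl] by blast
  then have nilpotent: "(\<phi> ^^ i) a = 0" if "a \<in> mradical (range (\<lambda>a. a - \<phi> a))" for a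
    using funpow_eq_0_if_mradical_range[OF endo char0] that by blast
  \<comment> \<open>The kernel of an iterate is an ideal contained in the image. With
    \<open>b = c = 1\<close> this gives the remaining inclusion of radicals, and with general
    factors the Mathieu property.\<close>
  have absorb: "b * a ^ m * c \<in> range (\<lambda>a. a - \<phi> a)" if "(\<phi> ^^ k) a = 0" "m \<ge> 1" for a b c k m
  proof (rule range_id_minus_if_funpow_eq_0[OF endo])
    show "(\<phi> ^^ k) (b * a ^ m * c) = 0"
      using that by (cases m) (simp_all add: funpow_mult_hom[OF endo])
  qed
  have "a \<in> mradical (range (\<lambda>a. a - \<phi> a))" if "(\<phi> ^^ k) a = 0" for a k
    unfolding mradical_def using absorb[OF that, of _ 1 1] by auto
  then have "mradical (range (\<lambda>a. a - \<phi> a)) = mradical (ker_ge1 \<phi>)"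
    using nilpotent mradical_ker_ge1[OF endo] by blast
  moreover have "subspace (range (\<lambda>a. a - \<phi> a))"
  proof (rule subspaceI)
    show "0 \<in> range (\<lambda>a. a - \<phi> a)" by (rule range_eqI[of _ _ 0]) (simp add: \<phi>.zero)
    show "x + y \<in> range (\<lambda>a. a - \<phi> a)"
      if xy: "x \<in> range (\<lambda>a. a - \<phi> a)" "y \<in> range (\<lambda>a. a - \<phi> a)" for x y
    proof -
      obtain u v where "x = u - \<phi> u" "y = v - \<phi> v" using xy by blast
      then show ?thesis by (intro range_eqI[of _ _ "u + v"]) (simp add: \<phi>.add)
    qed
    show "scale r x \<in> range (\<lambda>a. a - \<phi> a)" if x: "x \<in> range (\<lambda>a. a - \<phi> a)" for r x
    proof -
      obtain u where "x = u - \<phi> u" using x by blast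
      then show ?thesis
        by (intro range_eqI[of _ _ "scale r u"]) (simp add: \<phi>.scale scale_right_diff_distrib)
    qed
  qed
  moreover have "\<exists>N. \<forall>m\<ge>N. b * a ^ m * c \<in> range (\<lambda>a. a - \<phi> a)"
    if "\<forall>m\<ge>1. a ^ m \<in> range (\<lambda>a. a - \<phi> a)" for a b c
  proof -
    have "a \<in> mradical (range (\<lambda>a. a - \<phi> a))"
      using that unfolding mradical_def by blast
    then show ?thesis using absorb[OF nilpotent] by blast
  qed
  ultimately show ?thesis unfolding mathieu_subspace_def by blast
qed

end
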